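(* Let $N=\{1,\dots,n\}$, let $(\bm{x}_i,y_i)\in\mathbb{R}^d\times\{-1,1\}$ for $i\in N$, let $C>0$, and let $\lambda_k\ge0$ for $k\in N$ (not necessarily monotone). Given an optimal solution $(\bm{\alpha}^*,b^*,\bm{\xi}^*,\bm{\theta}^*,\bm{z}^* )$ of (NC-OWA-SVM$_D$), there can be built a feasible solution $(\bm{w}^*,b^*,\bm{\xi}^*,\bm{\theta}^*,\bm{z}^* )$ of (NC-OWA-SVM) (with the same $b^*,\bm{\xi}^*,\bm{\theta}^*,\bm{z}^*$) having the same objective value.
   Context: $M$ is a fixed (sufficiently large) big-$M$ constant, the same in both problems; the maximum distance between two points of the training data is taken as a valid value of $M$. The problem (NC-OWA-SVM) is $$\min_{\bm{w},b,\bm{\xi},\bm{z},\bm{\theta}}\ \frac12\|\bm{w}\|_2^2+C\sum_{k=1}^n\lambda_k\theta_k$$ subject to $$y_i(\bm{w}^T\bm{x}_i+b)\ge1-\xi_i,\quad i\in N,$$ $$\sum_{i=1}^nz_{ij}=1,\quad j\in N,$$ $$\theta_k\ge\xi_i-M\Bigl(1-\sum_{j=1}^{k}z_{ij}\Bigr),\quad i,k\in N,$$ $$z_{ik}\in\{0,1\}\ (i,k\in N),\quad \theta_k\ge0\ (k\in N),\quad \bm{w}\in\mathbb{R}^d,\quad b\in\mathbb{R},\quad \xi_i\ge0\ (i\in N).$$ The problem (NC-OWA-SVM$_D$), with variables $\bm{\alpha}\in\mathbb{R}^n$, $b,\bm{\xi},\bm{\theta},\bm{z}$, is $$\min_{\bm{\alpha},b,\bm{\xi},\bm{\theta},\bm{z}}\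 \frac12\sum_{i=1}^n\sum_{j=1}^ny_iy_j\alpha_i\alpha_j\,\bm{x}_i\cdot\bm{x}_j+C\sum_{k=1}^n\lambda_k\theta_k$$ subject to $$y_i\Bigl(\sum_{j=1}^ny_j\alpha_j\,\bm{x}_i\cdot\bm{x}_j+b\Bigr)\ge1-\xi_i,\quad i\in N,$$ $$\sum_{i=1}^nz_{ij}=1,\quad j\in N,$$ $$\theta_k\ge\xi_i-M\Bigl(1-\sum_{j=1}^{k}z_{ij}\Bigr),\quad i,k\in N,$$ $$z_{ik}\in\{0,1\}\ (i,k\in N),\quad \theta_k\ge0\ (k\in N),\quad b\in\mathbb{R},\quad \xi_i\ge0\ (i\in N).$$ *)

theory Defs
  imports "HOL-Analysis.Analysis"
begin

text \<open>
  The index set is \<open>N = {1..n}\<close>. Vectors indexed by \<open>N\<close> (and matrices indexed by \<open>N \<times> N\<close>) are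
  functions on \<^typ>\<open>nat\<close>; only their values at indices in \<open>N\<close> occur in constraints and objectives.
\<close>

definition owa_constraints ::
  "nat \<Rightarrow> real \<Rightarrow> (nat \<Rightarrow> real) \<Rightarrow> (nat \<Rightarrow> real) \<Rightarrow> (nat \<Rightarrow> nat \<Rightarrow> real) \<Rightarrow> bool" where
  "owa_constraints n M \<xi> \<theta> z \<longleftrightarrow>
     (\<forall>j\<in>{1..n}. (\<Sum>i=1..n. z i j) = 1) \<and>
     (\<forall>i\<in>{1..n}. \<forall>k\<in>{1..n}. \<theta> k \<ge> \<xi> i - M * (1 - (\<Sum>j=1..k. z i j))) \<and>
     (\<forall>i\<in>{1..n}. \<forall>k\<in>{1..n}. z i k \<in> {0, 1}) \<and>
     (\<forall>k\<in>{1..n}. \<theta> k \<ge> 0) \<and>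
     (\<forall>i\<in>{1..n}. \<xi> i \<ge> 0)"

type_synonym 'd primal_point =
  "(real ^ 'd) \<times> real \<times> (nat \<Rightarrow> real) \<times> (nat \<Rightarrow> real) \<times> (nat \<Rightarrow> nat \<Rightarrow> real)"

type_synonym dual_point =
  "(nat \<Rightarrow> real) \<times> real \<times> (nat \<Rightarrow> real) \<times> (nat \<Rightarrow> real) \<times> (nat \<Rightarrow> nat \<Rightarrow> real)"

text \<open>Points of (NC-OWA-SVM) are tuples \<open>(w, b, \<xi>, \<theta>, z)\<close>.\<close>

definition nc_owa_svm_feasible ::
  "nat \<Rightarrow> (nat \<Rightarrow> real ^ 'd) \<Rightarrow> (nat \<Rightarrow> real) \<Rightarrow> real \<Rightarrow> 'd primal_point \<Rightarrow> bool" where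
  "nc_owa_svm_feasible n x y M = (\<lambda>(w, b, \<xi>, \<theta>, z).
     (\<forall>i\<in>{1..n}. y i * (w \<bullet> x i + b) \<ge> 1 - \<xi> i) \<and> owa_constraints n M \<xi> \<theta> z)"

definition nc_owa_svm_objective ::
  "nat \<Rightarrow> real \<Rightarrow> (nat \<Rightarrow> real) \<Rightarrow> 'd::finite primal_point \<Rightarrow> real" where
  "nc_owa_svm_objective n C lam = (\<lambda>(w, b, \<xi>, \<theta>, z).
     1 / 2 * (norm w)\<^sup>2 + C * (\<Sum>k=1..n. lam k * \<theta> k))"

text \<open>Points of (NC-OWA-SVM\<open>\<^sub>D\<close>) are tuples \<open>(\<alpha>, b, \<xi>, \<theta>, z)\<close>; \<open>\<alpha>\<close> is unrestricted in sign.\<close>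

definition nc_owa_svm_D_feasible ::
  "nat \<Rightarrow> (nat \<Rightarrow> real ^ 'd) \<Rightarrow> (nat \<Rightarrow> real) \<Rightarrow> real \<Rightarrow> dual_point \<Rightarrow> bool" where
  "nc_owa_svm_D_feasible n x y M = (\<lambda>(\<alpha>, b, \<xi>, \<theta>, z).
     (\<forall>i\<in>{1..n}. y i * ((\<Sum>j=1..n. y j * \<alpha> j * (x i \<bullet> x j)) + b) \<ge> 1 - \<xi> i) \<and>
     owa_constraints n M \<xi> \<theta> z)"

definition nc_owa_svm_D_objective ::
  "nat \<Rightarrow> (nat \<Rightarrow> real ^ 'd) \<Rightarrow> (nat \<Rightarrow> real) \<Rightarrow> real \<Rightarrow> (nat \<Rightarrow> real) \<Rightarrow> dual_point \<Rightarrow> real" where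
  "nc_owa_svm_D_objective n x y C lam = (\<lambda>(\<alpha>, b, \<xi>, \<theta>, z).
     1 / 2 * (\<Sum>i=1..n. \<Sum>j=1..n. y i * y j * \<alpha> i * \<alpha> j * (x i \<bullet> x j))
       + C * (\<Sum>k=1..n. lam k * \<theta> k))"

end

theory Submission imports Defs
begin

text \<open>
  The witness is the kernel expansion \<open>w = (\<Sum>j=1..n. (y j * \<alpha> j) *\<^sub>R x j)\<close>. The dual point sees the
  data only through the Gram matrix \<open>x i \<bullet> x j\<close>, and by bilinearity of the inner product its margin
  terms are exactly \<open>w \<bullet> x i\<close> and its quadratic form is exactly \<open>(norm w)\<^sup>2\<close>. Hence constraints and
  objective agree term by term.
\<close>

lemma inner_sum_scaleR_left:
  fixes x :: "'i \<Rightarrow> 'a :: real_inner"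
  shows "(\<Sum>j\<in>A. c j *\<^sub>R x j) \<bullet> v = (\<Sum>j\<in>A. c j * (v \<bullet> x j))"
  by (simp add: inner_sum_left inner_commute[of v])

lemma norm_sum_scaleR_squared:
  fixes x :: "'i \<Rightarrow> 'a :: real_inner"
  shows "(norm (\<Sum>j\<in>A. c j *\<^sub>R x j))\<^sup>2 = (\<Sum>i\<in>A. \<Sum>j\<in>A. c i * c j * (x i \<bullet> x j))"
  by (simp add: power2_norm_eq_inner inner_sum_left inner_sum_right inner_commute
      sum_distrib_left mult_ac)

theorem proposition4p2:
  fixes n :: nat
    and x :: "nat \<Rightarrow> real ^ 'd"
    and y :: "nat \<Rightarrow> real"
    and C M :: real
    and lam :: "nat \<Rightarrow> real"
    and \<alpha> :: "nat \<Rightarrow> real" and b :: real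
    and \<xi> \<theta> :: "nat \<Rightarrow> real" and z :: "nat \<Rightarrow> nat \<Rightarrow> real"
  assumes "\<forall>i\<in>{1..n}. y i \<in> {-1, 1}"
    and "C > 0"
    and "\<forall>k\<in>{1..n}. lam k \<ge> 0"
    and "is_arg_min (nc_owa_svm_D_objective n x y C lam) (nc_owa_svm_D_feasible n x y M)
           (\<alpha>, b, \<xi>, \<theta>, z)"
  shows "\<exists>w :: real ^ 'd.
           nc_owa_svm_feasible n x y M (w, b, \<xi>, \<theta>, z) \<and>
           nc_owa_svm_objective n C lam (w, b, \<xi>, \<theta>, z) =
             nc_owa_svm_D_objective n x y C lam (\<alpha>, b, \<xi>, \<theta>, z)"
proof -
  define w where "w = (\<Sum>j=1..n. (y j * \<alpha> j) *\<^sub>R x j)"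
  have margin: "w \<bullet> x i = (\<Sum>j=1..n. y j * \<alpha> j * (x i \<bullet> x j))" for i
    unfolding w_def by (rule inner_sum_scaleR_left)
  have quadratic_form:
    "(norm w)\<^sup>2 = (\<Sum>i=1..n. \<Sum>j=1..n. y i * y j * \<alpha> i * \<alpha> j * (x i \<bullet> x j))"
    unfolding w_def norm_sum_scaleR_squared by (simp add: mult_ac)
  have "nc_owa_svm_D_feasible n x y M (\<alpha>, b, \<xi>, \<theta>, z)"
    using assms(4) by (simp add: is_arg_min_def)
  then have "nc_owa_svm_feasible n x y M (w, b, \<xi>, \<theta>, z)"
    by (simp add: nc_owa_svm_D_feasible_def nc_owa_svm_feasible_def margin)
  moreover have "nc_owa_svm_objective n C lam (w, b, \<xi>, \<theta>, z) =
      nc_owa_svm_D_objective n x y C lam (\<alpha>, b, \<xi>, \<theta>, z)"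
    by (simp add: nc_owa_svm_objective_def nc_owa_svm_D_objective_def quadratic_form)
  ultimately show ?thesis by blast
qed

end
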